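(* Let $(\mathfrak g,\kappa)$ be a complex metric Lie algebra of finite dimension $n$, let $x_*=(x_i)_{1\le i\le n}$ be a basis of $\mathfrak g$, and let $x^*=(x^i)_{1\le i\le n}$ be the basis of $\mathfrak g$ uniquely determined by $\kappa(x_i,x^j)=\delta_{i,j}$ for $1\le i,j\le n$. Then the tensor $$r(x_* )=\frac12\sum_{i=1}^n(x_i\otimes x^i+x^i\otimes x_i)\in\mathfrak g\otimes\mathfrak g$$ is an $r$-matrix for $\mathfrak g$ which satisfies the compatibility condition with respect to the Cartan cocycle $\kappa([-,-],-)$. Moreover, $r(x_* )$ does not depend on the choice of the basis $x_*$.
   Context: A metric Lie algebra $(\mathfrak g,\kappa)$ is a Lie algebra with a non-degenerate symmetric bilinear form $\kappa$ that is invariant: $\kappa([x,y],z)=\kappa(x,[y,z])$. An $r$-matrix for $\mathfrak g$ is a symmetric tensor $r\in\mathfrak g\otimes\mathfrak g$ that is invariant under the diagonal adjoint action of $\mathfrak g$. Compatibility condition: consider a short exact sequence of $\mathfrak g$-modules $0\to\mathbb C\xrightarrow{i}V_2\xrightarrow{d}V_3\to0$ with $\mathbb C$ trivial, a 2-cocycle $\alpha\in Z^2(\mathfrak g,V_3)$, a linear section $Q$ of $d$, $\omega=Q\circ\alpha$ and $\Phi=d_{CE}\omega:\Lambda^3\mathfrak g\to V_2$; put $1_{V_2}=i(1)$. The cochain $\Phi$ is of the form $\Phi=i\circ\gamma$ for a 3-cocycle $\gamma:\Lambda^3\mathfrak g\to\mathbb C$. The compatibility condition for $r=\sum_i s_i\otimes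 t_i$ is: for all $X,Y\in\mathfrak g$, $\sum_i\Phi(s_i,X,Y)\otimes t_i=1_{V_2}\otimes[X,Y]$ and $\sum_i s_i\otimes\Phi(t_i,X,Y)=[X,Y]\otimes1_{V_2}$. "With respect to the cocycle $\gamma$" means that $\Phi=i\circ\gamma$; since $1_{V_2}\neq0$, the condition is then equivalent to $\sum_i\gamma(s_i,X,Y)\,t_i=[X,Y]=\sum_i\gamma(t_i,X,Y)\,s_i$ for all $X,Y\in\mathfrak g$. Here $\gamma(X,Y,Z)=\kappa([X,Y],Z)$. *)

theory Defs
  imports Complex_Main "HOL-Library.Poly_Mapping" "HOL-Library.FuncSet"
begin

section \<open>Complex vector spaces\<close>

class scaleC =
  fixes scaleC :: "complex \<Rightarrow> 'a \<Rightarrow> 'a"  (infixr \<open>*\<^sub>C\<close> 75)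

class complex_vector = scaleC + ab_group_add +
  assumes scaleC_add_right: "a *\<^sub>C (x + y) = a *\<^sub>C x + a *\<^sub>C y"
    and scaleC_add_left: "(a + b) *\<^sub>C x = a *\<^sub>C x + b *\<^sub>C x"
    and scaleC_scaleC: "a *\<^sub>C (b *\<^sub>C x) = (a * b) *\<^sub>C x"
    and scaleC_one: "1 *\<^sub>C x = x"

global_interpretation cvs: vector_space "scaleC :: complex \<Rightarrow> 'a \<Rightarrow> 'a::complex_vector"
  by unfold_locales (simp_all add: scaleC_add_right scaleC_add_left scaleC_scaleC scaleC_one)

instantiation complex :: complex_vector
begin

definition scaleC_complex :: "complex \<Rightarrow> complex \<Rightarrow> complex" where
  "scaleC_complex a x = a * x"

instance
  by intro_classes (simp_all add: scaleC_complex_def algebra_simps)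

end

instantiation poly_mapping :: (type, complex_vector) complex_vector
begin

definition scaleC_poly_mapping :: "complex \<Rightarrow> ('a \<Rightarrow>\<^sub>0 'b) \<Rightarrow> 'a \<Rightarrow>\<^sub>0 'b" where
  "scaleC_poly_mapping a = Poly_Mapping.map (scaleC a)"

lemma lookup_scaleC [simp]:
  fixes p :: "'a \<Rightarrow>\<^sub>0 'b"
  shows "Poly_Mapping.lookup (a *\<^sub>C p) k = a *\<^sub>C Poly_Mapping.lookup p k"
  unfolding scaleC_poly_mapping_def by (simp add: map.rep_eq when_def)

instance
  by intro_classes
    (rule poly_mapping_eqI;
      simp add: lookup_add scaleC_add_right scaleC_add_left scaleC_scaleC scaleC_one)+

end

abbreviation clinear :: "('a::complex_vector \<Rightarrow> 'b::complex_vector) \<Rightarrow> bool" where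
  "clinear \<equiv> Vector_Spaces.linear scaleC scaleC"

definition cbilinear ::
  "('a::complex_vector \<Rightarrow> 'b::complex_vector \<Rightarrow> 'c::complex_vector) \<Rightarrow> bool" where
  "cbilinear b \<longleftrightarrow> (\<forall>y. clinear (\<lambda>x. b x y)) \<and> (\<forall>x. clinear (b x))"

text \<open>The existence of such a family is what says that the space has finite dimension \<open>n\<close>.\<close>

definition indexed_basis :: "nat \<Rightarrow> (nat \<Rightarrow> 'a::complex_vector) \<Rightarrow> bool" where
  "indexed_basis n x \<longleftrightarrow>
     inj_on x {1..n} \<and> \<not> cvs.dependent (x ` {1..n}) \<and> cvs.span (x ` {1..n}) = UNIV"


section \<open>The algebraic tensor product\<close>

text \<open>The quotient of the free complex vector space on pairs by the subspace spanned by the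
  bilinearity relations.\<close>

abbreviation free_pair :: "'a \<Rightarrow> 'b \<Rightarrow> ('a \<times> 'b) \<Rightarrow>\<^sub>0 complex" where
  "free_pair x y \<equiv> Poly_Mapping.single (x, y) 1"

definition tensor_relations ::
  "(('a::complex_vector \<times> 'b::complex_vector) \<Rightarrow>\<^sub>0 complex) set" where
  "tensor_relations =
     {free_pair (x + x') y - free_pair x y - free_pair x' y | x x' y. True} \<union>
     {free_pair x (y + y') - free_pair x y - free_pair x y' | x y y'. True} \<union>
     {free_pair (c *\<^sub>C x) y - c *\<^sub>C free_pair x y | c x y. True} \<union>
     {free_pair x (c *\<^sub>C y) - c *\<^sub>C free_pair x y | c x y. True}"

definition tensor_eq ::
  "(('a::complex_vector \<times> 'b::complex_vector) \<Rightarrow>\<^sub>0 complex) \<Rightarrow> (('a \<times> 'b) \<Rightarrow>\<^sub>0 complex) \<Rightarrow> bool"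
  where "tensor_eq p q \<longleftrightarrow> p - q \<in> cvs.span tensor_relations"

lemma equivp_tensor_eq: "equivp tensor_eq"
proof (rule equivpI)
  show "reflp tensor_eq"
    by (simp add: reflp_def tensor_eq_def cvs.span_zero)
  show "symp tensor_eq"
    unfolding symp_def tensor_eq_def by (auto dest: cvs.span_neg)
  show "transp tensor_eq"
    unfolding transp_def tensor_eq_def by (auto dest: cvs.span_add)
qed

quotient_type (overloaded) ('a, 'b) tensor =
  "(('a::complex_vector \<times> 'b::complex_vector) \<Rightarrow>\<^sub>0 complex)" / tensor_eq
  by (rule equivp_tensor_eq)

instantiation tensor :: (complex_vector, complex_vector) complex_vector
begin

lift_definition zero_tensor :: "('a, 'b) tensor" is 0 .

lift_definition plus_tensor :: "('a, 'b) tensor \<Rightarrow> ('a, 'b) tensor \<Rightarrow> ('a, 'b) tensor" is "(+)"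
  unfolding tensor_eq_def by (drule (1) cvs.span_add) (simp add: add_diff_add)

lift_definition uminus_tensor :: "('a, 'b) tensor \<Rightarrow> ('a, 'b) tensor" is uminus
  unfolding tensor_eq_def by (drule cvs.span_neg) simp

lift_definition minus_tensor :: "('a, 'b) tensor \<Rightarrow> ('a, 'b) tensor \<Rightarrow> ('a, 'b) tensor" is "(-)"
  unfolding tensor_eq_def by (drule (1) cvs.span_diff) (simp add: algebra_simps)

lift_definition scaleC_tensor :: "complex \<Rightarrow> ('a, 'b) tensor \<Rightarrow> ('a, 'b) tensor" is scaleC
  unfolding tensor_eq_def by (simp flip: cvs.scale_right_diff_distrib add: cvs.span_scale)

instance
  by intro_classes
    (transfer; simp add: tensor_eq_def algebra_simps cvs.span_zero)+

end

lift_definition tensor_pair ::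
  "'a::complex_vector \<Rightarrow> 'b::complex_vector \<Rightarrow> ('a, 'b) tensor"  (infixr \<open>\<otimes>\<^sub>t\<close> 72)
  is free_pair .

definition free_lift ::
  "('a \<Rightarrow> 'b \<Rightarrow> 'c::complex_vector) \<Rightarrow> (('a \<times> 'b) \<Rightarrow>\<^sub>0 complex) \<Rightarrow> 'c" where
  "free_lift b p = (\<Sum>(x, y)\<in>Poly_Mapping.keys p. Poly_Mapping.lookup p (x, y) *\<^sub>C b x y)"

text \<open>For bilinear \<open>b\<close> this is the linear map induced by the universal property, sending
  \<open>\<Sum>\<^sub>i s\<^sub>i \<otimes> t\<^sub>i\<close> to \<open>\<Sum>\<^sub>i b s\<^sub>i t\<^sub>i\<close>; see \<open>tensor_lift_unique\<close> below.
  It is meaningless for other \<open>b\<close>, as it then depends on the chosen representative.\<close>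

definition tensor_lift ::
  "('a::complex_vector \<Rightarrow> 'b::complex_vector \<Rightarrow> 'c::complex_vector) \<Rightarrow> ('a, 'b) tensor \<Rightarrow> 'c" where
  "tensor_lift b r = free_lift b (rep_tensor r)"

lemma free_lift_superset:
  assumes "finite A" "Poly_Mapping.keys p \<subseteq> A"
  shows "free_lift b p = (\<Sum>k\<in>A. Poly_Mapping.lookup p k *\<^sub>C b (fst k) (snd k))"
  unfolding free_lift_def case_prod_unfold
  by (rule sum.mono_neutral_cong_left[OF assms]) (auto simp: in_keys_iff)

lemma clinear_free_lift: "clinear (free_lift b)"
proof -
  have add: "free_lift b (p + q) = free_lift b p + free_lift b q" for p q
  proof -
    let ?A = "Poly_Mapping.keys p \<union> Poly_Mapping.keys q"
    have "free_lift b (p + q) = (\<Sum>k\<in>?A. Poly_Mapping.lookup (p + q) k *\<^sub>C b (fst k) (snd k))"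
      by (rule free_lift_superset) (use keys_add[of p q] in auto)
    also have "\<dots> = free_lift b p + free_lift b q"
      by (simp add: lookup_add scaleC_add_left sum.distrib free_lift_superset[of ?A p]
          free_lift_superset[of ?A q])
    finally show ?thesis .
  qed
  have scale: "free_lift b (c *\<^sub>C p) = c *\<^sub>C free_lift b p" for c p
  proof -
    let ?A = "Poly_Mapping.keys p"
    have "free_lift b (c *\<^sub>C p) = (\<Sum>k\<in>?A. Poly_Mapping.lookup (c *\<^sub>C p) k *\<^sub>C b (fst k) (snd k))"
      by (rule free_lift_superset) (auto simp: in_keys_iff)
    also have "\<dots> = c *\<^sub>C free_lift b p"
      by (simp add: scaleC_complex_def cvs.scale_sum_right free_lift_superset[of ?A p])
    finally show ?thesis .
  qed
  show ?thesis
    unfolding linear_iff_module_hom module_hom_iff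
    by (simp add: add scale cvs.module_axioms)
qed

lemma free_lift_pair: "free_lift b (free_pair x y) = b x y"
  unfolding free_lift_def by (simp add: scaleC_one)

lemma free_lift_tensor_eq:
  assumes b: "cbilinear b" and pq: "tensor_eq p q"
  shows "free_lift b p = free_lift b q"
proof -
  interpret L: Vector_Spaces.linear scaleC scaleC "free_lift b" by (rule clinear_free_lift)
  have bl: "b (x + x') y = b x y + b x' y" "b x (y + y') = b x y + b x y'"
    "b (c *\<^sub>C x) y = c *\<^sub>C b x y" "b x (c *\<^sub>C y) = c *\<^sub>C b x y" for x x' y y' c
    using b unfolding cbilinear_def linear_iff_module_hom module_hom_iff by auto
  have "p - q \<in> cvs.span tensor_relations" using pq by (simp add: tensor_eq_def)
  then have "free_lift b (p - q) = 0"
  proof (rule cvs.span_induct)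
    show "cvs.subspace {v. free_lift b v = 0}" by (rule L.subspace_kernel)
  next
    fix v :: "('a \<times> 'b) \<Rightarrow>\<^sub>0 complex"
    assume "v \<in> tensor_relations"
    then show "free_lift b v = 0"
      unfolding tensor_relations_def
      by (auto simp: L.diff L.scale free_lift_pair bl)
  qed
  then show ?thesis by (simp add: L.diff)
qed

lemma tensor_lift_abs:
  assumes "cbilinear b"
  shows "tensor_lift b (abs_tensor p) = free_lift b p"
  unfolding tensor_lift_def
  by (rule free_lift_tensor_eq[OF assms])
    (metis Quotient_rep_abs[OF Quotient_tensor] equivp_reflp[OF equivp_tensor_eq])

lemma tensor_lift_pair:
  assumes "cbilinear b"
  shows "tensor_lift b (x \<otimes>\<^sub>t y) = b x y"
  by (simp add: tensor_pair.abs_eq tensor_lift_abs[OF assms] free_lift_pair)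

lemma clinear_tensor_lift:
  assumes "cbilinear b"
  shows "clinear (tensor_lift b)"
proof -
  interpret L: Vector_Spaces.linear scaleC scaleC "free_lift b" by (rule clinear_free_lift)
  have "tensor_lift b (u + v) = tensor_lift b u + tensor_lift b v" for u v
    by (induct u, induct v) (simp add: plus_tensor.abs_eq tensor_lift_abs[OF assms] L.add)
  moreover have "tensor_lift b (c *\<^sub>C u) = c *\<^sub>C tensor_lift b u" for c u
    by (induct u) (simp add: scaleC_tensor.abs_eq tensor_lift_abs[OF assms] L.scale)
  ultimately show ?thesis
    unfolding linear_iff_module_hom module_hom_iff by (simp add: cvs.module_axioms)
qed

lemma free_span: "cvs.span (range (\<lambda>(x, y). free_pair x y)) = UNIV"
proof -
  have "p \<in> cvs.span (range (\<lambda>(x, y). free_pair x y))" for p :: "('a \<times> 'b) \<Rightarrow>\<^sub>0 complex"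
  proof -
    have "p = (\<Sum>k\<in>Poly_Mapping.keys p. Poly_Mapping.lookup p k *\<^sub>C free_pair (fst k) (snd k))"
      by (rule poly_mapping_eqI)
        (simp add: lookup_sum lookup_single when_def scaleC_complex_def in_keys_iff if_distrib
          cong: if_cong)
    also have "\<dots> \<in> cvs.span (range (\<lambda>(x, y). free_pair x y))"
      by (intro cvs.span_sum cvs.span_scale cvs.span_base) (auto simp: image_iff)
    finally show ?thesis .
  qed
  then show ?thesis by blast
qed

lemma tensor_lift_unique:
  assumes b: "cbilinear b" and f: "clinear f" and fb: "\<And>x y. f (x \<otimes>\<^sub>t y) = b x y"
  shows "f = tensor_lift b"
proof
  fix r
  interpret F: Vector_Spaces.linear scaleC scaleC f by (rule f)
  interpret L: Vector_Spaces.linear scaleC scaleC "tensor_lift b" by (rule clinear_tensor_lift[OF b])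
  have zero: "abs_tensor 0 = 0" by (simp add: zero_tensor.abs_eq)
  have "f (abs_tensor p) = tensor_lift b (abs_tensor p)" for p
  proof -
    have "p \<in> cvs.span (range (\<lambda>(x, y). free_pair x y))" unfolding free_span by (rule UNIV_I)
    then show ?thesis
    proof (induct rule: cvs.span_induct_alt)
      case base
      show ?case by (simp add: zero F.zero L.zero)
    next
      case (step c v w)
      then show ?case
        by (auto simp: F.add L.add F.scale L.scale fb tensor_lift_pair[OF b]
            simp flip: plus_tensor.abs_eq scaleC_tensor.abs_eq tensor_pair.abs_eq)
    qed
  qed
  then show "f r = tensor_lift b r" by (induct r) simp
qed


section \<open>Metric Lie algebras and modules\<close>

locale lie_algebra =
  fixes br :: "'g::complex_vector \<Rightarrow> 'g \<Rightarrow> 'g"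
  assumes bilinear_br: "cbilinear br"
    and br_self: "br x x = 0"
    and jacobi: "br x (br y z) + br y (br z x) + br z (br x y) = 0"

locale metric_lie_algebra = lie_algebra br
  for br :: "'g::complex_vector \<Rightarrow> 'g \<Rightarrow> 'g" +
  fixes \<kappa> :: "'g \<Rightarrow> 'g \<Rightarrow> complex"
  assumes bilinear_form: "cbilinear \<kappa>"
    and form_sym: "\<kappa> x y = \<kappa> y x"
    and form_nondegenerate: "(\<And>y. \<kappa> x y = 0) \<Longrightarrow> x = 0"
    and form_invariant: "\<kappa> (br x y) z = \<kappa> x (br y z)"

definition lie_module ::
  "('g::complex_vector \<Rightarrow> 'g \<Rightarrow> 'g) \<Rightarrow> ('g \<Rightarrow> 'v::complex_vector \<Rightarrow> 'v) \<Rightarrow> bool" where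
  "lie_module br \<rho> \<longleftrightarrow>
     cbilinear \<rho> \<and> (\<forall>x y v. \<rho> (br x y) v = \<rho> x (\<rho> y v) - \<rho> y (\<rho> x v))"

definition lie_module_hom ::
  "('g \<Rightarrow> 'v::complex_vector \<Rightarrow> 'v) \<Rightarrow> ('g \<Rightarrow> 'w::complex_vector \<Rightarrow> 'w) \<Rightarrow> ('v \<Rightarrow> 'w) \<Rightarrow> bool" where
  "lie_module_hom \<rho> \<sigma> f \<longleftrightarrow> clinear f \<and> (\<forall>x v. f (\<rho> x v) = \<sigma> x (f v))"

abbreviation trivial_action :: "'g \<Rightarrow> complex \<Rightarrow> complex" where
  "trivial_action x c \<equiv> 0"


section \<open>Chevalley-Eilenberg cochains in degrees 2 and 3\<close>

definition cochain2 :: "('g::complex_vector \<Rightarrow> 'g \<Rightarrow> 'v::complex_vector) \<Rightarrow> bool" where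
  "cochain2 \<alpha> \<longleftrightarrow> cbilinear \<alpha> \<and> (\<forall>x. \<alpha> x x = 0)"

definition cochain3 :: "('g::complex_vector \<Rightarrow> 'g \<Rightarrow> 'g \<Rightarrow> 'v::complex_vector) \<Rightarrow> bool" where
  "cochain3 \<gamma> \<longleftrightarrow>
     (\<forall>y z. clinear (\<lambda>x. \<gamma> x y z)) \<and> (\<forall>x z. clinear (\<lambda>y. \<gamma> x y z)) \<and> (\<forall>x y. clinear (\<gamma> x y)) \<and>
     (\<forall>x y. \<gamma> x x y = 0 \<and> \<gamma> x y y = 0)"

definition d_CE2 ::
  "('g \<Rightarrow> 'g \<Rightarrow> 'g) \<Rightarrow> ('g \<Rightarrow> 'v::complex_vector \<Rightarrow> 'v) \<Rightarrow> ('g \<Rightarrow> 'g \<Rightarrow> 'v) \<Rightarrow> 'g \<Rightarrow> 'g \<Rightarrow> 'g \<Rightarrow> 'v"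
  where
  "d_CE2 br \<rho> \<omega> x y z =
     \<rho> x (\<omega> y z) - \<rho> y (\<omega> x z) + \<rho> z (\<omega> x y)
     - \<omega> (br x y) z + \<omega> (br x z) y - \<omega> (br y z) x"

definition d_CE3 ::
  "('g \<Rightarrow> 'g \<Rightarrow> 'g) \<Rightarrow> ('g \<Rightarrow> 'v::complex_vector \<Rightarrow> 'v) \<Rightarrow> ('g \<Rightarrow> 'g \<Rightarrow> 'g \<Rightarrow> 'v)
     \<Rightarrow> 'g \<Rightarrow> 'g \<Rightarrow> 'g \<Rightarrow> 'g \<Rightarrow> 'v"
  where
  "d_CE3 br \<rho> \<gamma> x y z w =
     \<rho> x (\<gamma> y z w) - \<rho> y (\<gamma> x z w) + \<rho> z (\<gamma> x y w) - \<rho> w (\<gamma> x y z)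
     - \<gamma> (br x y) z w + \<gamma> (br x z) y w - \<gamma> (br x w) y z
     - \<gamma> (br y z) x w + \<gamma> (br y w) x z - \<gamma> (br z w) x y"

definition cocycle2 ::
  "('g::complex_vector \<Rightarrow> 'g \<Rightarrow> 'g) \<Rightarrow> ('g \<Rightarrow> 'v::complex_vector \<Rightarrow> 'v) \<Rightarrow> ('g \<Rightarrow> 'g \<Rightarrow> 'v) \<Rightarrow> bool"
  where
  "cocycle2 br \<rho> \<alpha> \<longleftrightarrow> cochain2 \<alpha> \<and> (\<forall>x y z. d_CE2 br \<rho> \<alpha> x y z = 0)"

definition cocycle3 ::
  "('g::complex_vector \<Rightarrow> 'g \<Rightarrow> 'g) \<Rightarrow> ('g \<Rightarrow> 'v::complex_vector \<Rightarrow> 'v) \<Rightarrow> ('g \<Rightarrow> 'g \<Rightarrow> 'g \<Rightarrow> 'v) \<Rightarrow> bool"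
  where
  "cocycle3 br \<rho> \<gamma> \<longleftrightarrow> cochain3 \<gamma> \<and> (\<forall>x y z w. d_CE3 br \<rho> \<gamma> x y z w = 0)"

definition cartan_cocycle ::
  "('g \<Rightarrow> 'g \<Rightarrow> 'g) \<Rightarrow> ('g \<Rightarrow> 'g \<Rightarrow> complex) \<Rightarrow> 'g \<Rightarrow> 'g \<Rightarrow> 'g \<Rightarrow> complex" where
  "cartan_cocycle br \<kappa> x y z = \<kappa> (br x y) z"


section \<open>r-matrices and the compatibility condition\<close>

definition tensor_flip :: "('a::complex_vector, 'b::complex_vector) tensor \<Rightarrow> ('b, 'a) tensor" where
  "tensor_flip = tensor_lift (\<lambda>s t. t \<otimes>\<^sub>t s)"

definition diagonal_ad ::
  "('g::complex_vector \<Rightarrow> 'g \<Rightarrow> 'g) \<Rightarrow> 'g \<Rightarrow> ('g, 'g) tensor \<Rightarrow> ('g, 'g) tensor" where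
  "diagonal_ad br x = tensor_lift (\<lambda>s t. br x s \<otimes>\<^sub>t t + s \<otimes>\<^sub>t br x t)"

definition r_matrix ::
  "('g::complex_vector \<Rightarrow> 'g \<Rightarrow> 'g) \<Rightarrow> ('g, 'g) tensor \<Rightarrow> bool" where
  "r_matrix br r \<longleftrightarrow> tensor_flip r = r \<and> (\<forall>x. diagonal_ad br x r = 0)"

text \<open>The short exact sequence \<open>0 \<rightarrow> \<complex> \<rightarrow> V\<^sub>2 \<rightarrow> V\<^sub>3 \<rightarrow> 0\<close> of modules with maps \<open>i\<close>, \<open>d\<close> and
  actions \<open>\<rho>\<^sub>2\<close>, \<open>\<rho>\<^sub>3\<close>, a 2-cocycle \<open>\<alpha>\<close> with values in \<open>V\<^sub>3\<close>, and a linear section \<open>Q\<close> of \<open>d\<close>.\<close>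

locale extension_data = lie_algebra br
  for br :: "'g::complex_vector \<Rightarrow> 'g \<Rightarrow> 'g" +
  fixes \<rho>\<^sub>2 :: "'g \<Rightarrow> 'v::complex_vector \<Rightarrow> 'v"
    and \<rho>\<^sub>3 :: "'g \<Rightarrow> 'w::complex_vector \<Rightarrow> 'w"
    and i :: "complex \<Rightarrow> 'v"
    and d :: "'v \<Rightarrow> 'w"
    and \<alpha> :: "'g \<Rightarrow> 'g \<Rightarrow> 'w"
    and Q :: "'w \<Rightarrow> 'v"
  assumes module2: "lie_module br \<rho>\<^sub>2"
    and module3: "lie_module br \<rho>\<^sub>3"
    and hom_i: "lie_module_hom trivial_action \<rho>\<^sub>2 i"
    and hom_d: "lie_module_hom \<rho>\<^sub>2 \<rho>\<^sub>3 d"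
    and inj_i: "inj i"
    and exact: "range i = {v. d v = 0}"
    and surj_d: "surj d"
    and cocycle_alpha: "cocycle2 br \<rho>\<^sub>3 \<alpha>"
    and linear_Q: "clinear Q"
    and section_Q: "d (Q u) = u"

definition extension_Phi ::
  "('g \<Rightarrow> 'g \<Rightarrow> 'g) \<Rightarrow> ('g \<Rightarrow> 'v::complex_vector \<Rightarrow> 'v) \<Rightarrow> ('g \<Rightarrow> 'g \<Rightarrow> 'w) \<Rightarrow> ('w \<Rightarrow> 'v)
     \<Rightarrow> 'g \<Rightarrow> 'g \<Rightarrow> 'g \<Rightarrow> 'v" where
  "extension_Phi br \<rho>\<^sub>2 \<alpha> Q = d_CE2 br \<rho>\<^sub>2 (\<lambda>x y. Q (\<alpha> x y))"

definition compatible ::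
  "('g::complex_vector \<Rightarrow> 'g \<Rightarrow> 'g) \<Rightarrow> ('g \<Rightarrow> 'g \<Rightarrow> 'g \<Rightarrow> 'v::complex_vector) \<Rightarrow> 'v
     \<Rightarrow> ('g, 'g) tensor \<Rightarrow> bool" where
  "compatible br \<Phi> one r \<longleftrightarrow>
     (\<forall>X Y. tensor_lift (\<lambda>s t. \<Phi> s X Y \<otimes>\<^sub>t t) r = one \<otimes>\<^sub>t br X Y \<and>
            tensor_lift (\<lambda>s t. s \<otimes>\<^sub>t \<Phi> t X Y) r = br X Y \<otimes>\<^sub>t one)"

text \<open>The form the condition takes when \<open>\<Phi> = i \<circ> \<gamma>\<close> for a 3-cocycle \<open>\<gamma>\<close>; as \<open>i 1 \<noteq> 0\<close>, no
  reference to the extension remains.\<close>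

definition compatible_wrt ::
  "('g::complex_vector \<Rightarrow> 'g \<Rightarrow> 'g) \<Rightarrow> ('g \<Rightarrow> 'g \<Rightarrow> 'g \<Rightarrow> complex) \<Rightarrow> ('g, 'g) tensor \<Rightarrow> bool" where
  "compatible_wrt br \<gamma> r \<longleftrightarrow>
     cocycle3 br trivial_action \<gamma> \<and>
     (\<forall>X Y. tensor_lift (\<lambda>s t. \<gamma> s X Y *\<^sub>C t) r = br X Y \<and>
            tensor_lift (\<lambda>s t. \<gamma> t X Y *\<^sub>C s) r = br X Y)"


section \<open>The tensor attached to a basis\<close>

text \<open>Families indexed by \<open>{1..n}\<close> are made unique as functions on \<open>nat\<close> by \<open>extensional\<close>.\<close>

definition dual_basis ::
  "('g \<Rightarrow> 'g \<Rightarrow> complex) \<Rightarrow> nat \<Rightarrow> (nat \<Rightarrow> 'g::complex_vector) \<Rightarrow> nat \<Rightarrow> 'g" where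
  "dual_basis \<kappa> n x =
     (THE y. y \<in> extensional {1..n} \<and> indexed_basis n y \<and>
        (\<forall>i\<in>{1..n}. \<forall>j\<in>{1..n}. \<kappa> (x i) (y j) = (if i = j then 1 else 0)))"

definition r_tensor ::
  "('g \<Rightarrow> 'g \<Rightarrow> complex) \<Rightarrow> nat \<Rightarrow> (nat \<Rightarrow> 'g::complex_vector) \<Rightarrow> ('g, 'g) tensor" where
  "r_tensor \<kappa> n x =
     (1 / 2) *\<^sub>C (\<Sum>i\<in>{1..n}. x i \<otimes>\<^sub>t dual_basis \<kappa> n x i + dual_basis \<kappa> n x i \<otimes>\<^sub>t x i)"

end

theory Submission
  imports Defs
begin

text \<open>If \<open>x\<close>, \<open>y\<close> and \<open>x'\<close>, \<open>y'\<close> are two pairs of dual bases and \<open>A\<close> has the adjoint \<open>A'\<close> with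
  respect to \<open>\<kappa>\<close>, then expanding both sides gives
  \<open>\<Sum>\<^sub>i A x\<^sub>i \<otimes> y\<^sub>i = \<Sum>\<^sub>j x'\<^sub>j \<otimes> A' y'\<^sub>j\<close>. For \<open>A = id\<close> this is the independence of the basis and, taking
  \<open>x' = y\<close>, \<open>y' = x\<close>, the symmetry of \<open>\<Sum>\<^sub>i x\<^sub>i \<otimes> y\<^sub>i\<close>, which therefore equals \<open>r(x)\<close>. For \<open>A = ad z\<close>,
  which is skew-adjoint, it is the invariance. The compatibility condition is the expansion
  of \<open>[X, Y]\<close> in dual bases.\<close>

text \<open>Keeps the simplifier from rewriting \<open>{1..n}\<close> to \<open>{Suc 0..n}\<close>,
  where facts about the index set would no longer match.\<close>

declare One_nat_def [simp del]

section \<open>Bilinear maps and tensors\<close>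

lemma clinearI:
  assumes "\<And>u v. f (u + v) = f u + f v" "\<And>c u. f (c *\<^sub>C u) = c *\<^sub>C f u"
  shows "clinear f"
  unfolding linear_iff_module_hom module_hom_iff using assms by (simp add: cvs.module_axioms)

lemma clinearD:
  assumes "clinear f"
  shows "f (u + v) = f u + f v" "f (c *\<^sub>C u) = c *\<^sub>C f u"
  using assms unfolding linear_iff_module_hom module_hom_iff by auto

lemma cbilinearI:
  assumes "\<And>u u' v. b (u + u') v = b u v + b u' v" "\<And>u v v'. b u (v + v') = b u v + b u v'"
    "\<And>c u v. b (c *\<^sub>C u) v = c *\<^sub>C b u v" "\<And>c u v. b u (c *\<^sub>C v) = c *\<^sub>C b u v"
  shows "cbilinear b"
  unfolding cbilinear_def using assms by (auto intro!: clinearI)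

lemma cbilinear_linear:
  assumes "cbilinear b"
  shows "clinear (\<lambda>u. b u v)" "clinear (b u)"
  using assms unfolding cbilinear_def by auto

lemma cbilinearD:
  assumes "cbilinear b"
  shows "b (u + u') v = b u v + b u' v" "b u (v + v') = b u v + b u v'"
    "b (c *\<^sub>C u) v = c *\<^sub>C b u v" "b u (c *\<^sub>C v) = c *\<^sub>C b u v"
  using clinearD[OF cbilinear_linear(1)[OF assms]] clinearD[OF cbilinear_linear(2)[OF assms]]
  by auto

lemma cbilinear_sum:
  assumes "cbilinear b"
  shows "b (\<Sum>i\<in>A. f i) v = (\<Sum>i\<in>A. b (f i) v)" "b u (\<Sum>i\<in>A. g i) = (\<Sum>i\<in>A. b u (g i))"
proof -
  interpret L: Vector_Spaces.linear scaleC scaleC "\<lambda>u. b u v"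
    by (rule cbilinear_linear[OF assms])
  interpret R: Vector_Spaces.linear scaleC scaleC "b u"
    by (rule cbilinear_linear[OF assms])
  show "b (\<Sum>i\<in>A. f i) v = (\<Sum>i\<in>A. b (f i) v)" by (rule L.sum)
  show "b u (\<Sum>i\<in>A. g i) = (\<Sum>i\<in>A. b u (g i))" by (rule R.sum)
qed

lemma cbilinear_group:
  assumes "cbilinear b"
  shows "b (- u) v = - b u v" "b u (- v) = - b u v" "b (u - u') v = b u v - b u' v" "b u (v - v') = b u v - b u v'"
    "b 0 v = 0" "b u 0 = 0"
proof -
  interpret L: Vector_Spaces.linear scaleC scaleC "\<lambda>u. b u v"
    by (rule cbilinear_linear[OF assms])
  interpret R: Vector_Spaces.linear scaleC scaleC "b u"
    by (rule cbilinear_linear[OF assms])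
  show "b (- u) v = - b u v" "b u (- v) = - b u v" "b (u - u') v = b u v - b u' v" "b u (v - v') = b u v - b u v'"
    "b 0 v = 0" "b u 0 = 0"
    by (fact L.neg R.neg L.diff R.diff L.zero R.zero)+
qed

lemma cbilinear_tensor_pair: "cbilinear (\<otimes>\<^sub>t)"
proof (rule cbilinearI)
  have *: "tensor_eq p q" if "p - q \<in> tensor_relations"
    for p q :: "('a \<times> 'b) \<Rightarrow>\<^sub>0 complex"
    using that unfolding tensor_eq_def by (rule cvs.span_base)
  show "(u + u') \<otimes>\<^sub>t v = u \<otimes>\<^sub>t v + u' \<otimes>\<^sub>t v" for u u' :: 'a and v :: 'b
    \<comment> \<open>The difference arises as \<open>a - (b + c)\<close>; the reversed
      \<open>diff_diff_eq\<close> gives it the shape \<open>a - b - c\<close> of the generators of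
      \<open>tensor_relations\<close>.\<close>
    by transfer (rule *, unfold tensor_relations_def diff_diff_eq[symmetric], blast)
  show "u \<otimes>\<^sub>t (v + v') = u \<otimes>\<^sub>t v + u \<otimes>\<^sub>t v'" for u :: 'a and v v' :: 'b
    by transfer (rule *, unfold tensor_relations_def diff_diff_eq[symmetric], blast)
  show "c *\<^sub>C u \<otimes>\<^sub>t v = c *\<^sub>C (u \<otimes>\<^sub>t v)" for c and u :: 'a and v :: 'b
    by transfer (rule *, unfold tensor_relations_def, blast)
  show "u \<otimes>\<^sub>t c *\<^sub>C v = c *\<^sub>C (u \<otimes>\<^sub>t v)" for c and u :: 'a and v :: 'b
    by transfer (rule *, unfold tensor_relations_def, blast)
qed

lemmas tensor_pair_simps = cbilinearD[OF cbilinear_tensor_pair]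
  and tensor_pair_sum = cbilinear_sum[OF cbilinear_tensor_pair]
  and tensor_pair_group = cbilinear_group[OF cbilinear_tensor_pair]

lemma tensor_lift_sum:
  assumes "cbilinear b"
  shows "tensor_lift b (\<Sum>i\<in>A. s i \<otimes>\<^sub>t t i) = (\<Sum>i\<in>A. b (s i) (t i))"
proof -
  interpret L: Vector_Spaces.linear scaleC scaleC "tensor_lift b"
    by (rule clinear_tensor_lift[OF assms])
  show ?thesis by (simp add: L.sum tensor_lift_pair[OF assms])
qed

section \<open>Dual bases and the Casimir tensor\<close>

text \<open>Duality is encoded by the two expansions instead of by Kronecker deltas: the
  computations with Casimir tensors use exactly these, and for symmetric \<open>\<kappa>\<close> the
  condition is visibly symmetric in \<open>x\<close> and \<open>y\<close>.\<close>

definition dual_pair ::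
  "('g \<Rightarrow> 'g \<Rightarrow> complex) \<Rightarrow> nat \<Rightarrow> (nat \<Rightarrow> 'g::complex_vector) \<Rightarrow> (nat \<Rightarrow> 'g) \<Rightarrow> bool" where
  "dual_pair \<kappa> n x y \<longleftrightarrow>
     (\<forall>v. (\<Sum>i\<in>{1..n}. \<kappa> v (y i) *\<^sub>C x i) = v) \<and> (\<forall>v. (\<Sum>i\<in>{1..n}. \<kappa> (x i) v *\<^sub>C y i) = v)"

text \<open>Both sides are the double sum of the \<open>x' j \<otimes>\<^sub>t y i\<close> with
  coefficients \<open>\<kappa> (A (x i)) (y' j) = \<kappa> (x i) (A' (y' j))\<close>: summing over
  \<open>j\<close> first gives \<open>A (x i)\<close>, summing over \<open>i\<close> first gives
  \<open>A' (y' j)\<close>.\<close>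

lemma casimir_adjoint:
  assumes xy: "dual_pair \<kappa> n x y" and xy': "dual_pair \<kappa> m x' y'"
    and adj: "\<And>u v. \<kappa> (A u) v = \<kappa> u (A' v)"
  shows "(\<Sum>i\<in>{1..n}. A (x i) \<otimes>\<^sub>t y i) = (\<Sum>j\<in>{1..m}. x' j \<otimes>\<^sub>t A' (y' j))"
proof -
  have "(\<Sum>i\<in>{1..n}. A (x i) \<otimes>\<^sub>t y i)
      = (\<Sum>i\<in>{1..n}. (\<Sum>j\<in>{1..m}. \<kappa> (A (x i)) (y' j) *\<^sub>C x' j) \<otimes>\<^sub>t y i)"
    using xy' by (simp add: dual_pair_def)
  also have "\<dots> = (\<Sum>i\<in>{1..n}. \<Sum>j\<in>{1..m}. x' j \<otimes>\<^sub>t (\<kappa> (x i) (A' (y' j)) *\<^sub>C y i))"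
    by (simp add: tensor_pair_simps tensor_pair_sum adj)
  also have "\<dots> = (\<Sum>j\<in>{1..m}. x' j \<otimes>\<^sub>t (\<Sum>i\<in>{1..n}. \<kappa> (x i) (A' (y' j)) *\<^sub>C y i))"
    by (subst sum.swap) (simp add: tensor_pair_sum)
  also have "\<dots> = (\<Sum>j\<in>{1..m}. x' j \<otimes>\<^sub>t A' (y' j))"
    using xy by (simp add: dual_pair_def)
  finally show ?thesis .
qed

section \<open>Bases as indexed families\<close>

lemma indexed_basis_expand:
  assumes "indexed_basis n x"
  obtains c where "v = (\<Sum>i\<in>{1..n}. c i *\<^sub>C x i)"
proof -
  have "v \<in> cvs.span (x ` {1..n})" and inj: "inj_on x {1..n}"
    using assms by (auto simp: indexed_basis_def)
  then obtain u where "v = (\<Sum>b\<in>x ` {1..n}. u b *\<^sub>C b)"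
    by (auto simp: cvs.span_finite)
  then have "v = (\<Sum>i\<in>{1..n}. u (x i) *\<^sub>C x i)"
    by (simp add: sum.reindex[OF inj])
  then show ?thesis by (rule that)
qed

lemma indexed_basis_independent:
  assumes "indexed_basis n x" "(\<Sum>i\<in>{1..n}. c i *\<^sub>C x i) = 0" "i \<in> {1..n}"
  shows "c i = 0"
proof -
  have inj: "inj_on x {1..n}" and ind: "\<not> cvs.dependent (x ` {1..n})"
    using assms(1) by (auto simp: indexed_basis_def)
  \<comment> \<open>Independence of a set concerns coefficients attached to vectors, so
    \<open>c\<close> is transported along the inverse of the injective \<open>x\<close>.\<close>
  have "(\<Sum>b\<in>x ` {1..n}. c (the_inv_into {1..n} x b) *\<^sub>C b) = (\<Sum>i\<in>{1..n}. c i *\<^sub>C x i)"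
    by (simp add: sum.reindex[OF inj] the_inv_into_f_f[OF inj])
  then have "c (the_inv_into {1..n} x (x i)) = 0"
    using ind assms(2,3) by (intro cvs.independentD[OF ind, of "x ` {1..n}"]) auto
  then show ?thesis by (simp add: the_inv_into_f_f[OF inj assms(3)])
qed

lemma indexed_basisI:
  assumes span: "\<And>v. \<exists>c. v = (\<Sum>i\<in>{1..n}. c i *\<^sub>C x i)"
    and indep: "\<And>c i. (\<Sum>i\<in>{1..n}. c i *\<^sub>C x i) = 0 \<Longrightarrow> i \<in> {1..n} \<Longrightarrow> c i = 0"
  shows "indexed_basis n x"
  unfolding indexed_basis_def
proof (intro conjI)
  show inj: "inj_on x {1..n}"
  proof (rule inj_onI, rule ccontr)
    fix i j assume ij: "i \<in> {1..n}" "j \<in> {1..n}" "x i = x j" "i \<noteq> j"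
    \<comment> \<open>A repeated vector would give the vanishing combination
      \<open>x i - x j\<close>, whose coefficient at \<open>i\<close> is 1.\<close>
    let ?c = "\<lambda>k. (if k = i then 1 else 0) - (if k = j then 1 else 0)"
    have "(\<Sum>k\<in>{1..n}. ?c k *\<^sub>C x k)
        = (\<Sum>k\<in>{1..n}. (if k = i then x k else 0) - (if k = j then x k else 0))"
      by (rule sum.cong) (auto simp: cvs.scale_left_diff_distrib scaleC_one)
    also have "\<dots> = 0" using ij by (simp add: sum_subtractf)
    finally show False using indep[of ?c i] ij(1,4) by simp
  qed
  show "\<not> cvs.dependent (x ` {1..n})"
  proof (rule cvs.independent_if_scalars_zero)
    fix f b assume sum0: "(\<Sum>b\<in>x ` {1..n}. f b *\<^sub>C b) = 0" and "b \<in> x ` {1..n}"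
    then obtain i where i: "i \<in> {1..n}" "b = x i" by auto
    from sum0 have "(\<Sum>i\<in>{1..n}. f (x i) *\<^sub>C x i) = 0" by (simp add: sum.reindex[OF inj])
    then have "f (x i) = 0" using i(1) by (rule indep)
    then show "f b = 0" using i(2) by simp
  qed simp
  show "cvs.span (x ` {1..n}) = UNIV"
  proof -
    have "v \<in> cvs.span (x ` {1..n})" for v
    proof -
      obtain c where "v = (\<Sum>i\<in>{1..n}. c i *\<^sub>C x i)" using span by blast
      then show ?thesis
        by (simp only:) (intro cvs.span_sum cvs.span_scale cvs.span_base imageI)
    qed
    then show ?thesis by blast
  qed
qed

section \<open>Dual bases with respect to the invariant form\<close>

context metric_lie_algebra
begin

lemmas br_simps = cbilinearD[OF bilinear_br]
  and br_group = cbilinear_group[OF bilinear_br]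
  and form_simps = cbilinearD[OF bilinear_form]
  and form_sum = cbilinear_sum[OF bilinear_form]
  and form_group = cbilinear_group[OF bilinear_form]

lemma br_skew: "br u v = - br v u"
proof -
  have "br u v + br v u = br (u + v) (u + v)"
    by (simp only: br_simps) (simp add: br_self)
  also have "\<dots> = 0" by (rule br_self)
  finally show ?thesis by (rule eq_neg_iff_add_eq_0[THEN iffD2])
qed

text \<open>Skew-adjointness of \<open>br z\<close>, in the form of the hypothesis
  \<open>adj\<close> of \<open>casimir_adjoint\<close>.\<close>

lemma form_ad: "\<kappa> (br z u) v = \<kappa> u (- br z v)"
proof -
  have "\<kappa> (br z u) v = - \<kappa> (br u z) v"
    by (subst br_skew) (rule form_group)
  then show ?thesis by (simp add: form_invariant form_group)
qed

text \<open>Pairing an expansion in \<open>x\<close> with \<open>y j\<close> reads off its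
  coefficients, which gives the first formula. For the second, \<open>y\<close> is not yet known to
  span; but the defect \<open>w\<close> is orthogonal to every \<open>x j\<close>, hence to all
  vectors, and vanishes by nondegeneracy.\<close>

lemma dual_pair_dual:
  assumes x: "indexed_basis n x"
    and dual: "\<And>i j. i \<in> {1..n} \<Longrightarrow> j \<in> {1..n} \<Longrightarrow> \<kappa> (x i) (y j) = (if i = j then 1 else 0)"
  shows "dual_pair \<kappa> n x y"
  unfolding dual_pair_def
proof (intro conjI allI)
  fix v
  obtain c where c: "v = (\<Sum>i\<in>{1..n}. c i *\<^sub>C x i)" by (rule indexed_basis_expand[OF x])
  have "\<kappa> v (y j) = c j" if "j \<in> {1..n}" for j
  proof -
    have "\<kappa> v (y j) = (\<Sum>i\<in>{1..n}. if i = j then c i else 0)"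
      unfolding c form_sum
      by (rule sum.cong) (use that in \<open>auto simp: form_simps dual scaleC_complex_def\<close>)
    then show ?thesis using that by simp
  qed
  then show "(\<Sum>i\<in>{1..n}. \<kappa> v (y i) *\<^sub>C x i) = v" by (simp add: c)
next
  fix v
  define w where "w = (\<Sum>i\<in>{1..n}. \<kappa> (x i) v *\<^sub>C y i) - v"
  have xw: "\<kappa> (x j) w = 0" if "j \<in> {1..n}" for j
  proof -
    have "\<kappa> (x j) (\<Sum>i\<in>{1..n}. \<kappa> (x i) v *\<^sub>C y i) = (\<Sum>i\<in>{1..n}. if j = i then \<kappa> (x i) v else 0)"
      unfolding form_sum
      by (rule sum.cong) (use that in \<open>auto simp: form_simps dual scaleC_complex_def\<close>)
    then show ?thesis using that by (simp add: w_def form_simps form_group)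
  qed
  have "\<kappa> w u = 0" for u
  proof -
    obtain c where "u = (\<Sum>i\<in>{1..n}. c i *\<^sub>C x i)" by (rule indexed_basis_expand[OF x])
    then show ?thesis
      by (subst form_sym) (simp add: form_sum form_simps xw)
  qed
  then have "w = 0" by (rule form_nondegenerate)
  then show "(\<Sum>i\<in>{1..n}. \<kappa> (x i) v *\<^sub>C y i) = v" by (simp add: w_def)
qed

text \<open>The second expansion of \<open>dual_pair\<close> gives spanning, and pairing a vanishing
  combination with \<open>x j\<close> gives independence.\<close>

lemma indexed_basis_dual:
  assumes x: "indexed_basis n x"
    and dual: "\<And>i j. i \<in> {1..n} \<Longrightarrow> j \<in> {1..n} \<Longrightarrow> \<kappa> (x i) (y j) = (if i = j then 1 else 0)"
  shows "indexed_basis n y"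
proof (rule indexed_basisI)
  fix v
  show "\<exists>c. v = (\<Sum>i\<in>{1..n}. c i *\<^sub>C y i)"
    using dual_pair_dual[OF x dual] unfolding dual_pair_def by metis
next
  fix c j assume c: "(\<Sum>i\<in>{1..n}. c i *\<^sub>C y i) = 0" and j: "j \<in> {1..n}"
  have "\<kappa> (x j) (\<Sum>i\<in>{1..n}. c i *\<^sub>C y i) = (\<Sum>i\<in>{1..n}. if j = i then c i else 0)"
    unfolding form_sum
    by (rule sum.cong) (use j in \<open>auto simp: form_simps dual scaleC_complex_def\<close>)
  then show "c j = 0" using j by (simp add: c form_group)
qed

lemma dual_basis_exists:
  assumes x: "indexed_basis n x"
  obtains y where
    "\<And>i j. i \<in> {1..n} \<Longrightarrow> j \<in> {1..n} \<Longrightarrow> \<kappa> (x i) (y j) = (if i = j then 1 else 0)"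
proof -
  interpret fd: finite_dimensional_vector_space "scaleC :: complex \<Rightarrow> 'g \<Rightarrow> 'g" "x ` {1..n}"
    by unfold_locales (use x in \<open>auto simp: indexed_basis_def\<close>)
  \<comment> \<open>\<open>T v\<close> has the values of the functional
    \<open>\<kappa> (-) v\<close> on the basis as its coordinates. Encoding functionals by vectors
    makes \<open>T\<close> an endomorphism, which is injective by nondegeneracy and therefore
    surjective in finite dimension.\<close>
  define T where "T v = (\<Sum>i\<in>{1..n}. \<kappa> (x i) v *\<^sub>C x i)" for v
  have T: "clinear T"
    by (rule clinearI)
      (simp_all add: T_def form_simps scaleC_add_left sum.distrib cvs.scale_sum_right
        scaleC_scaleC scaleC_complex_def)
  interpret T: Vector_Spaces.linear scaleC scaleC T by (rule T)
  have "v = 0" if "T v = 0" for v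
  proof (rule form_nondegenerate)
    fix u
    obtain c where "u = (\<Sum>i\<in>{1..n}. c i *\<^sub>C x i)" by (rule indexed_basis_expand[OF x])
    moreover have "\<kappa> (x i) v = 0" if "i \<in> {1..n}" for i
      using x \<open>T v = 0\<close>[unfolded T_def] that by (rule indexed_basis_independent)
    ultimately show "\<kappa> v u = 0"
      by (subst form_sym) (simp add: form_sum form_simps)
  qed
  then have "inj T" by (simp add: T.inj_iff_eq_0)
  then have surj: "surj T" by (rule fd.linear_inj_imp_surj[OF T])
  \<comment> \<open>Comparing coordinates in \<open>T (y j) = x j\<close> yields exactly the duality
    relations.\<close>
  define y where "y j = inv T (x j)" for j
  have "\<kappa> (x i) (y j) = (if i = j then 1 else 0)" if ij: "i \<in> {1..n}" "j \<in> {1..n}" for i j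
  proof -
    have "(\<Sum>k\<in>{1..n}. (if k = j then 1 else 0) *\<^sub>C x k) = (\<Sum>k\<in>{1..n}. if k = j then x k else 0)"
      by (rule sum.cong) (auto simp: scaleC_one)
    also have "\<dots> = T (y j)"
      using ij(2) by (simp add: y_def surj_f_inv_f[OF surj])
    finally have "(\<Sum>k\<in>{1..n}. (\<kappa> (x k) (y j) - (if k = j then 1 else 0)) *\<^sub>C x k) = 0"
      by (simp add: T_def cvs.scale_left_diff_distrib sum_subtractf)
    then have "\<kappa> (x i) (y j) - (if i = j then 1 else 0) = 0"
      using ij(1) by (rule indexed_basis_independent[OF x])
    then show ?thesis by simp
  qed
  then show ?thesis by (rule that)
qed

lemma dual_pair_dual_basis:
  assumes x: "indexed_basis n x"
  shows "dual_pair \<kappa> n x (dual_basis \<kappa> n x)"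
proof -
  let ?P = "\<lambda>y. y \<in> extensional {1..n} \<and> indexed_basis n y \<and>
        (\<forall>i\<in>{1..n}. \<forall>j\<in>{1..n}. \<kappa> (x i) (y j) = (if i = j then 1 else 0))"
  obtain y where y: "\<And>i j. i \<in> {1..n} \<Longrightarrow> j \<in> {1..n} \<Longrightarrow> \<kappa> (x i) (y j) = (if i = j then 1 else 0)"
    using x by (rule dual_basis_exists) blast
  \<comment> \<open>The restriction fixes the values outside \<open>{1..n}\<close>, so that
    \<open>y'\<close> can be the unique function described in \<open>dual_basis\<close>.\<close>
  define y' where "y' = restrict y {1..n}"
  have y': "\<kappa> (x i) (y' j) = (if i = j then 1 else 0)" if "i \<in> {1..n}" "j \<in> {1..n}" for i j
    using that by (simp add: y'_def y)
  have "?P y'"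
    using indexed_basis_dual[OF x y'] y' by (auto simp: y'_def simp del: restrict_apply)
  moreover have "z = y'" if z: "?P z" for z
  proof (rule extensionalityI)
    show "z \<in> extensional {1..n}" "y' \<in> extensional {1..n}" using z \<open>?P y'\<close> by auto
    fix j assume j: "j \<in> {1..n}"
    \<comment> \<open>Uniqueness: \<open>z j\<close> and \<open>y' j\<close> have the same pairings
      with all \<open>x i\<close>, hence the same expansion in \<open>y'\<close>.\<close>
    have "z j = (\<Sum>i\<in>{1..n}. \<kappa> (x i) (z j) *\<^sub>C y' i)"
      using dual_pair_dual[OF x y'] by (simp add: dual_pair_def)
    also have "\<dots> = (\<Sum>i\<in>{1..n}. \<kappa> (x i) (y' j) *\<^sub>C y' i)"
      using z j y' by simp
    also have "\<dots> = y' j"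
      using dual_pair_dual[OF x y'] by (simp add: dual_pair_def)
    finally show "z j = y' j" .
  qed
  ultimately have "?P (dual_basis \<kappa> n x)"
    unfolding dual_basis_def by (rule theI)
  then show ?thesis by (intro dual_pair_dual[OF x]) blast
qed

section \<open>The Casimir tensor and its r-matrix property\<close>

lemma dual_pair_sym: "dual_pair \<kappa> n x y \<Longrightarrow> dual_pair \<kappa> n y x"
  by (simp add: dual_pair_def form_sym)

lemma casimir_unique:
  assumes "dual_pair \<kappa> n x y" "dual_pair \<kappa> m x' y'"
  shows "(\<Sum>i\<in>{1..n}. x i \<otimes>\<^sub>t y i) = (\<Sum>j\<in>{1..m}. x' j \<otimes>\<^sub>t y' j)"
  using assms by (rule casimir_adjoint[where A = "\<lambda>u. u" and A' = "\<lambda>u. u"]) simp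

text \<open>The two halves of the symmetrised sum are the Casimir tensors of the dual pair of
  \<open>x\<close> and of the swapped pair, so each equals that of \<open>y\<close> and
  \<open>z\<close>. As \<open>y\<close> and \<open>z\<close> are arbitrary, this also carries the
  independence of the basis.\<close>

lemma r_tensor_eq_casimir:
  assumes "indexed_basis n x" and xy: "dual_pair \<kappa> m y z"
  shows "r_tensor \<kappa> n x = (\<Sum>i\<in>{1..m}. y i \<otimes>\<^sub>t z i)"
proof -
  let ?C = "\<Sum>i\<in>{1..m}. y i \<otimes>\<^sub>t z i"
  have d: "dual_pair \<kappa> n x (dual_basis \<kappa> n x)" by (rule dual_pair_dual_basis) fact
  have "r_tensor \<kappa> n x = (1 / 2) *\<^sub>C (?C + ?C)"
    unfolding r_tensor_def sum.distrib casimir_unique[OF d xy]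
      casimir_unique[OF dual_pair_sym[OF d] xy] ..
  also have "\<dots> = (1 / 2 + 1 / 2) *\<^sub>C ?C"
    by (simp only: scaleC_add_left scaleC_add_right)
  finally show ?thesis by (simp add: scaleC_one)
qed

lemma r_matrix_casimir:
  assumes d: "dual_pair \<kappa> n x y"
  shows "r_matrix br (\<Sum>i\<in>{1..n}. x i \<otimes>\<^sub>t y i)"
  unfolding r_matrix_def
proof (intro conjI allI)
  have "cbilinear (\<lambda>s t :: 'g. t \<otimes>\<^sub>t s)"
    by (rule cbilinearI) (simp_all add: tensor_pair_simps)
  then have "tensor_flip (\<Sum>i\<in>{1..n}. x i \<otimes>\<^sub>t y i) = (\<Sum>i\<in>{1..n}. y i \<otimes>\<^sub>t x i)"
    unfolding tensor_flip_def by (rule tensor_lift_sum)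
  also have "\<dots> = (\<Sum>i\<in>{1..n}. x i \<otimes>\<^sub>t y i)"
    by (rule casimir_unique[OF dual_pair_sym[OF d] d])
  finally show "tensor_flip (\<Sum>i\<in>{1..n}. x i \<otimes>\<^sub>t y i) = (\<Sum>i\<in>{1..n}. x i \<otimes>\<^sub>t y i)" .
next
  fix z
  have "cbilinear (\<lambda>s t. br z s \<otimes>\<^sub>t t + s \<otimes>\<^sub>t br z t)"
    by (rule cbilinearI)
      (simp_all add: tensor_pair_simps br_simps algebra_simps scaleC_add_right)
  then have "diagonal_ad br z (\<Sum>i\<in>{1..n}. x i \<otimes>\<^sub>t y i)
      = (\<Sum>i\<in>{1..n}. br z (x i) \<otimes>\<^sub>t y i) + (\<Sum>i\<in>{1..n}. x i \<otimes>\<^sub>t br z (y i))"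
    unfolding diagonal_ad_def by (simp add: tensor_lift_sum sum.distrib)
  \<comment> \<open>\<open>casimir_adjoint\<close> is used with the same dual pair on both sides, so
    the first summand becomes the negative of the second.\<close>
  also have "(\<Sum>i\<in>{1..n}. br z (x i) \<otimes>\<^sub>t y i) = (\<Sum>i\<in>{1..n}. x i \<otimes>\<^sub>t (- br z (y i)))"
    using d d by (rule casimir_adjoint) (rule form_ad)
  finally show "diagonal_ad br z (\<Sum>i\<in>{1..n}. x i \<otimes>\<^sub>t y i) = 0"
    by (simp add: tensor_pair_group sum_negf)
qed

section \<open>The Cartan cocycle and the compatibility condition\<close>

lemma cocycle3_cartan_cocycle: "cocycle3 br trivial_action (cartan_cocycle br \<kappa>)"
  unfolding cocycle3_def
proof (intro conjI allI)
  show "cochain3 (cartan_cocycle br \<kappa>)"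
    unfolding cochain3_def cartan_cocycle_def
    \<comment> \<open>The last \<open>simp\<close> treats equal second and third arguments, where
      invariance gives \<open>\<kappa> (br x y) y = \<kappa> x (br y y)\<close>.\<close>
    by (auto intro!: clinearI simp: br_simps form_simps br_self form_group)
      (simp add: form_invariant br_self form_group)
next
  fix x y z w
  \<comment> \<open>With the trivial action only the six bracket terms of \<open>d_CE3\<close>
    survive. \<open>form_br\<close> isolates \<open>w\<close> in the three terms where it sits
    inside the brackets; \<open>sw\<close> and \<open>sw2\<close> normalise the order of the
    brackets. The total is then twice the Jacobi sum \<open>J\<close> paired with
    \<open>w\<close>.\<close>
  have form_br: "\<kappa> (br (br u w) v) t = - \<kappa> (br u (br v t)) w" for u v t
    by (simp add: form_invariant form_ad form_group form_sym[of w])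
       (metis br_skew form_invariant form_group(1) form_sym)
  have "\<kappa> (br x (br y z) + br y (br z x) + br z (br x y)) w = 0"
    by (simp add: jacobi form_group)
  then have J: "\<kappa> (br x (br y z)) w + \<kappa> (br y (br z x)) w + \<kappa> (br z (br x y)) w = 0"
    by (simp add: form_simps)
  have sw: "\<kappa> (br (br u v) t) w = - \<kappa> (br t (br u v)) w" for u v t
    by (subst br_skew) (rule form_group)
  have sw2: "\<kappa> (br y (br x z)) w = - \<kappa> (br y (br z x)) w"
    by (subst br_skew[of x z]) (simp add: form_group br_group)
  show "d_CE3 br trivial_action (cartan_cocycle br \<kappa>) x y z w = 0"
    unfolding d_CE3_def cartan_cocycle_def
    using J by (simp add: form_br sw sw2) algebra
qed

text \<open>By invariance \<open>\<kappa> (br (x i) X) Y = \<kappa> (x i) (br X Y)\<close>, which is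
  the coefficient of \<open>y i\<close> in the expansion of \<open>br X Y\<close>; the second
  formula belongs to the swapped pair.\<close>

lemma casimir_expand:
  assumes d: "dual_pair \<kappa> n x y"
  shows "(\<Sum>i\<in>{1..n}. \<kappa> (br (x i) X) Y *\<^sub>C y i) = br X Y"
    "(\<Sum>i\<in>{1..n}. \<kappa> (br (y i) X) Y *\<^sub>C x i) = br X Y"
  using d dual_pair_sym[OF d] by (simp_all add: form_invariant dual_pair_def)

lemma compatible_wrt_casimir:
  assumes d: "dual_pair \<kappa> n x y"
  shows "compatible_wrt br (cartan_cocycle br \<kappa>) (\<Sum>i\<in>{1..n}. x i \<otimes>\<^sub>t y i)"
  unfolding compatible_wrt_def
proof (intro conjI allI)
  fix X Y
  have b: "cbilinear (\<lambda>s t. \<kappa> (br s X) Y *\<^sub>C t)" "cbilinear (\<lambda>s t. \<kappa> (br t X) Y *\<^sub>C s)"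
    by (auto intro!: cbilinearI simp: br_simps form_simps scaleC_add_left
        scaleC_add_right scaleC_scaleC scaleC_complex_def mult.commute)
  show
    "tensor_lift (\<lambda>s t. cartan_cocycle br \<kappa> s X Y *\<^sub>C t) (\<Sum>i\<in>{1..n}. x i \<otimes>\<^sub>t y i) = br X Y"
    "tensor_lift (\<lambda>s t. cartan_cocycle br \<kappa> t X Y *\<^sub>C s) (\<Sum>i\<in>{1..n}. x i \<otimes>\<^sub>t y i) = br X Y"
    unfolding cartan_cocycle_def b[THEN tensor_lift_sum] by (fact casimir_expand[OF d])+
qed (rule cocycle3_cartan_cocycle)

lemma compatible_casimir:
  assumes d: "dual_pair \<kappa> n x y" and i: "clinear i"
    and Phi: "\<And>X Y Z. \<Phi> X Y Z = i (cartan_cocycle br \<kappa> X Y Z)"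
  shows "compatible br \<Phi> (i 1) (\<Sum>i\<in>{1..n}. x i \<otimes>\<^sub>t y i)"
  unfolding compatible_def
proof (intro allI)
  fix X Y
  \<comment> \<open>Since \<open>i\<close> takes values in the line through \<open>i 1\<close>, each
    value of \<open>\<Phi>\<close> is a scalar times \<open>i 1\<close>. The scalar can be moved
    across the tensor sign, which leaves the sums of \<open>casimir_expand\<close>.\<close>
  have i1: "i c = c *\<^sub>C i 1" for c
    using clinearD(2)[OF i, of c 1] by (simp add: scaleC_complex_def)
  have Phi': "\<Phi> s X Y = \<kappa> (br s X) Y *\<^sub>C i 1" for s
    by (subst i1[symmetric]) (simp add: Phi cartan_cocycle_def)
  have b: "cbilinear (\<lambda>s t. \<Phi> s X Y \<otimes>\<^sub>t t)" "cbilinear (\<lambda>s t. s \<otimes>\<^sub>t \<Phi> t X Y)"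
    by (auto intro!: cbilinearI simp: Phi' br_simps form_simps scaleC_add_left
        scaleC_add_right scaleC_scaleC scaleC_complex_def tensor_pair_simps mult.commute)
  have "(\<Sum>i\<in>{1..n}. \<Phi> (x i) X Y \<otimes>\<^sub>t y i)
      = i 1 \<otimes>\<^sub>t (\<Sum>i\<in>{1..n}. \<kappa> (br (x i) X) Y *\<^sub>C y i)"
    and "(\<Sum>i\<in>{1..n}. x i \<otimes>\<^sub>t \<Phi> (y i) X Y)
      = (\<Sum>i\<in>{1..n}. \<kappa> (br (y i) X) Y *\<^sub>C x i) \<otimes>\<^sub>t i 1"
    by (simp_all add: tensor_pair_sum tensor_pair_simps Phi')
  then show "tensor_lift (\<lambda>s t. \<Phi> s X Y \<otimes>\<^sub>t t) (\<Sum>i\<in>{1..n}. x i \<otimes>\<^sub>t y i) = i 1 \<otimes>\<^sub>t br X Y \<and>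
      tensor_lift (\<lambda>s t. s \<otimes>\<^sub>t \<Phi> t X Y) (\<Sum>i\<in>{1..n}. x i \<otimes>\<^sub>t y i) = br X Y \<otimes>\<^sub>t i 1"
    by (simp add: tensor_lift_sum b casimir_expand[OF d])
qed

end

theorem proposition6:
  fixes br :: "'g::complex_vector \<Rightarrow> 'g \<Rightarrow> 'g"
    and \<kappa> :: "'g \<Rightarrow> 'g \<Rightarrow> complex"
    and n :: nat
    and x :: "nat \<Rightarrow> 'g"
  assumes "metric_lie_algebra br \<kappa>"
    and "indexed_basis n x"
  shows "r_matrix br (r_tensor \<kappa> n x)
    \<and> compatible_wrt br (cartan_cocycle br \<kappa>) (r_tensor \<kappa> n x)
    \<and> (\<forall>(\<rho>\<^sub>2 :: 'g \<Rightarrow> 'v::complex_vector \<Rightarrow> 'v) (\<rho>\<^sub>3 :: 'g \<Rightarrow> 'w::complex_vector \<Rightarrow> 'w) i d \<alpha> Q.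
         extension_data br \<rho>\<^sub>2 \<rho>\<^sub>3 i d \<alpha> Q \<longrightarrow>
         (\<forall>X Y Z. extension_Phi br \<rho>\<^sub>2 \<alpha> Q X Y Z = i (cartan_cocycle br \<kappa> X Y Z)) \<longrightarrow>
         compatible br (extension_Phi br \<rho>\<^sub>2 \<alpha> Q) (i 1) (r_tensor \<kappa> n x))
    \<and> (\<forall>x'. indexed_basis n x' \<longrightarrow> r_tensor \<kappa> n x' = r_tensor \<kappa> n x)"
proof -
  interpret metric_lie_algebra br \<kappa> by fact
  have d: "dual_pair \<kappa> n x (dual_basis \<kappa> n x)" using assms(2) by (rule dual_pair_dual_basis)
  let ?C = "\<Sum>i\<in>{1..n}. x i \<otimes>\<^sub>t dual_basis \<kappa> n x i"
  \<comment> \<open>The case \<open>x' = x\<close> transfers the properties of \<open>?C\<close> to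
    \<open>r_tensor \<kappa> n x\<close>; arbitrary \<open>x'\<close> gives the
    independence.\<close>
  have r: "r_tensor \<kappa> n x' = ?C" if "indexed_basis n x'" for x'
    using that d by (rule r_tensor_eq_casimir)
  have "compatible br (extension_Phi br \<rho>\<^sub>2 \<alpha> Q) (i 1) ?C"
    if "extension_data br \<rho>\<^sub>2 \<rho>\<^sub>3 i d \<alpha> Q"
      and "\<forall>X Y Z. extension_Phi br \<rho>\<^sub>2 \<alpha> Q X Y Z = i (cartan_cocycle br \<kappa> X Y Z)"
    for \<rho>\<^sub>2 :: "'g \<Rightarrow> 'v \<Rightarrow> 'v" and \<rho>\<^sub>3 :: "'g \<Rightarrow> 'w \<Rightarrow> 'w" and i d \<alpha> Q
  proof (rule compatible_casimir)
    show "clinear i"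
      using extension_data.hom_i[OF that(1)] by (simp add: lie_module_hom_def)
  qed (use d that(2) in auto)
  then show ?thesis
    using r_matrix_casimir[OF d] compatible_wrt_casimir[OF d] r assms(2) by auto
qed

end
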